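(* Let $T \subset \mathbb{R}^2$ be a convex polygon (compact, with non-empty interior). For an edge $e$ of $T$, denote by $\overline{e}$ the line supporting $e$ and by $\mathring{e}$ the relative interior of $e$. Then the traces of the regular $3$-bounce billiard orbits on $T$ are exactly the Fagnano triangles of those triangles $\Delta$ such that: $\Delta$ is an acute triangle containing $T$ cut out by the lines $\overline{e}_1,\overline{e}_2,\overline{e}_3$ for some triple of edges $e_1,e_2,e_3$ of $T$, and for all $\{i,j,k\}=\{1,2,3\}$ the orthogonal projection of the point $\overline{e}_i\cap\overline{e}_j$ to $\overline{e}_k$ lies in $\mathring{e}_k$.
   Context: An outward support vector of $T$ at $q\in\partial T$ is a vector $\nu$ with $\langle x-q,\nu\rangle\le0$ for all $x\in T$. A point $q\in\partial T$ is smooth if there is a unique line through $q$ disjoint from the interior of $T$. A generalised billiard orbit on $T$ is a sequence $q_i\in\partial T$, $i\in\mathbb{Z}$ (consecutive points distinct), such that for every $i$ the vector $\frac{q_i-q_{i-1}}{\|q_i-q_{i-1}\|}+\frac{q_i-q_{i+1}}{\|q_i-q_{i+1}\|}$ is an outward support vector of $T$ at $q_i$; it is regular if all $q_i$ are smooth. It is closed if $q_{i+n}=q_i$ for all $i$ for some $n\ge2$, and an $n$-bounce orbit if $n$ is the smallest such integer. Closed orbits with the same trace are identified. A triangle is acute if all its angles are $<\frac{\pi}{2}$. The Fagnano triangle of an acute triangle is the triangle whose vertices are the feet of its three altitudes. *)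

theory Defs
  imports "HOL-Analysis.Analysis"
begin

type_synonym plane = "real ^ 2"

definition convex_polygon :: "plane set \<Rightarrow> bool" where
  "convex_polygon T \<longleftrightarrow> polytope T \<and> interior T \<noteq> {}"

definition is_line :: "plane set \<Rightarrow> bool" where
  "is_line L \<longleftrightarrow> affine L \<and> aff_dim L = 1"

text \<open>The zero vector is allowed as a support vector.\<close>

definition outward_support_vector :: "plane set \<Rightarrow> plane \<Rightarrow> plane \<Rightarrow> bool" where
  "outward_support_vector T q v \<longleftrightarrow> q \<in> frontier T \<and> (\<forall>x\<in>T. (x - q) \<bullet> v \<le> 0)"

definition smooth_point :: "plane set \<Rightarrow> plane \<Rightarrow> bool" where
  "smooth_point T q \<longleftrightarrow>
     q \<in> frontier T \<and> (\<exists>!L. is_line L \<and> q \<in> L \<and> L \<inter> interior T = {})"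

definition billiard_orbit :: "plane set \<Rightarrow> (int \<Rightarrow> plane) \<Rightarrow> bool" where
  "billiard_orbit T q \<longleftrightarrow>
     (\<forall>i. q i \<in> frontier T) \<and>
     (\<forall>i. q i \<noteq> q (i + 1)) \<and>
     (\<forall>i. outward_support_vector T (q i)
            ((q i - q (i - 1)) /\<^sub>R norm (q i - q (i - 1)) +
             (q i - q (i + 1)) /\<^sub>R norm (q i - q (i + 1))))"

definition regular_orbit :: "plane set \<Rightarrow> (int \<Rightarrow> plane) \<Rightarrow> bool" where
  "regular_orbit T q \<longleftrightarrow> billiard_orbit T q \<and> (\<forall>i. smooth_point T (q i))"

definition closes_after :: "(int \<Rightarrow> plane) \<Rightarrow> nat \<Rightarrow> bool" where
  "closes_after q n \<longleftrightarrow> n \<ge> 2 \<and> (\<forall>i. q (i + int n) = q i)"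

definition bounce_orbit :: "nat \<Rightarrow> plane set \<Rightarrow> (int \<Rightarrow> plane) \<Rightarrow> bool" where
  "bounce_orbit n T q \<longleftrightarrow>
     billiard_orbit T q \<and> closes_after q n \<and> (\<forall>m<n. \<not> closes_after q m)"

definition orbit_trace :: "(int \<Rightarrow> plane) \<Rightarrow> plane set" where
  "orbit_trace q = (\<Union>i. closed_segment (q i) (q (i + 1)))"

definition vertex_angle :: "plane \<Rightarrow> plane \<Rightarrow> plane \<Rightarrow> real" where
  "vertex_angle A B C = arccos (((B - A) \<bullet> (C - A)) / (norm (B - A) * norm (C - A)))"

definition acute_triangle :: "plane \<Rightarrow> plane \<Rightarrow> plane \<Rightarrow> bool" where
  "acute_triangle A B C \<longleftrightarrow>
     \<not> collinear {A, B, C} \<and>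
     vertex_angle A B C < pi / 2 \<and>
     vertex_angle B C A < pi / 2 \<and>
     vertex_angle C A B < pi / 2"

text \<open>Well-defined whenever \<open>L\<close> is a non-empty affine subspace, in particular a line.\<close>

definition orthogonal_projection :: "plane set \<Rightarrow> plane \<Rightarrow> plane" where
  "orthogonal_projection L p = (THE x. x \<in> L \<and> (\<forall>y\<in>L. orthogonal (p - x) (y - x)))"

text \<open>
  To be comparable with the trace of an orbit, the Fagnano triangle is taken as a
  closed polygonal curve, that is, as the union of its three sides.
\<close>

definition fagnano_triangle :: "plane \<Rightarrow> plane \<Rightarrow> plane \<Rightarrow> plane set" where
  "fagnano_triangle A B C =
     (let A' = orthogonal_projection (affine hull {B, C}) A;
          B' = orthogonal_projection (affine hull {C, A}) B;
          C' = orthogonal_projection (affine hull {A, B}) C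
      in closed_segment A' B' \<union> closed_segment B' C' \<union> closed_segment C' A')"

text \<open>
  The triangle with vertices \<open>A\<close>, \<open>B\<close>, \<open>C\<close> is cut out by the lines \<open>a\<close>, \<open>b\<close>, \<open>c\<close>,
  where the side opposite to each vertex lies on the line of the same name.
\<close>

definition cut_out_by ::
  "plane \<Rightarrow> plane \<Rightarrow> plane \<Rightarrow> plane set \<Rightarrow> plane set \<Rightarrow> plane set \<Rightarrow> bool" where
  "cut_out_by A B C a b c \<longleftrightarrow> b \<inter> c = {A} \<and> c \<inter> a = {B} \<and> a \<inter> b = {C}"

end

theory Submission
  imports Defs
begin

text \<open>
  At a bounce point \<open>P\<close> with neighbours \<open>Q\<close> and \<open>R\<close> the reflection law concerns the sum of two unit vectors,
  which points along the bisector of the angle \<open>QPR\<close>. If \<open>P\<close> is smooth and this vector does not vanish,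
  there is only one supporting line at \<open>P\<close>, namely the line through an edge containing \<open>P\<close> in its relative
  interior, and the law says that it is the external bisector of the triangle \<open>PQR\<close> at \<open>P\<close>
  (\<open>smooth_point_imp_edge\<close>, \<open>edge_hyperplane\<close>).

  Hence the three edge lines of a non-degenerate regular orbit \<open>PQR\<close> with three bounces are the external
  bisectors of \<open>PQR\<close>. They meet in pairs in the excenters. The internal bisectors are orthogonal to the
  external ones and pass through the excenters, so they are the altitudes of the excentral triangle, and
  \<open>P\<close>, \<open>Q\<close>, \<open>R\<close> are their feet (\<open>excenter_projection\<close>). The excentral triangle is acute
  (\<open>excentral_acute\<close>), and it contains the polygon, being cut out by the supporting half-planes
  (\<open>excentral_hull\<close>). In a degenerate orbit the three points are collinear; then one of the outer points
  has two supporting lines and is not smooth (\<open>collinear_bounce_not_smooth\<close>).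

  Conversely, the altitudes of an acute triangle bisect the angles of its orthic triangle
  (\<open>orthic_bounce_vector\<close>). So the feet satisfy the reflection law with respect to the triangle, and also
  with respect to a polygon inside it that touches the sides there. The feet are smooth because they lie in
  the relative interior of edges (\<open>rel_interior_edge_smooth\<close>).
\<close>

section \<open>Lines and orthogonal projections\<close>

lemma inner_diff_eq:
  fixes v :: "'a::real_inner"
  shows "(x - q) \<bullet> v = v \<bullet> x - v \<bullet> q"
  by (metis inner_commute inner_diff_right)

lemma is_line_hyperplane:
  fixes v :: plane
  assumes "v \<noteq> 0"
  shows "is_line {x. (x - q) \<bullet> v = 0}"
proof -
  have eq: "{x. (x - q) \<bullet> v = 0} = {x. v \<bullet> x = v \<bullet> q}"
    by (simp add: inner_diff_eq)
  show ?thesis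
    unfolding is_line_def eq using assms by (simp add: affine_hyperplane)
qed

lemma is_line_eqI:
  assumes "is_line L" "is_line M" "L \<subseteq> M"
  shows "L = M"
proof -
  have "L \<noteq> {}"
    using assms(1) unfolding is_line_def by auto
  then show ?thesis
    using assms affine_dim_equal[of L M] unfolding is_line_def by simp
qed

lemma is_line_affine_hull_2:
  fixes B C :: plane
  assumes "B \<noteq> C"
  shows "is_line (affine hull {B, C})"
  using assms by (simp add: is_line_def)

lemma affine_hull_2_eq_line:
  assumes "is_line L" "B \<in> L" "C \<in> L" "B \<noteq> C"
  shows "affine hull {B, C} = L"
proof (rule is_line_eqI[OF is_line_affine_hull_2[OF assms(4)] assms(1)])
  show "affine hull {B, C} \<subseteq> L"
    using assms by (intro hull_minimal) (auto simp: is_line_def)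
qed

lemma line_normal_form:
  assumes "is_line L" "q \<in> L"
  obtains v where "v \<noteq> 0" "L = {x. (x - q) \<bullet> v = 0}"
proof -
  have dim: "aff_dim L = int (DIM(plane) - 1)" and hull: "affine hull L = L"
    using assms(1) by (simp_all add: is_line_def)
  obtain a b where ab: "a \<noteq> 0" "affine hull L = {x. a \<bullet> x = b}"
    using aff_dim_eq_hyperplane[of L] dim by auto
  note eq = ab(2)[unfolded hull]
  have b: "b = a \<bullet> q"
    using assms(2)[unfolded eq] by simp
  show ?thesis
    by (rule that[OF ab(1)]) (simp add: eq b inner_diff_eq)
qed

text \<open>
  Two candidates \<open>x\<close> and \<open>z\<close> agree because \<open>z - x\<close> is orthogonal to itself.
\<close>

lemma orthogonal_projection_eqI:
  assumes "x \<in> L" and orth: "\<And>y. y \<in> L \<Longrightarrow> (p - x) \<bullet> (y - x) = 0"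
  shows "orthogonal_projection L p = x"
  unfolding orthogonal_projection_def
proof (rule the_equality)
  show "x \<in> L \<and> (\<forall>y\<in>L. orthogonal (p - x) (y - x))"
    using assms by (simp add: orthogonal_def)
next
  fix z assume z: "z \<in> L \<and> (\<forall>y\<in>L. orthogonal (p - z) (y - z))"
  have "(p - x) \<bullet> (z - x) = 0" "(p - z) \<bullet> (x - z) = 0"
    using z assms by (auto simp: orthogonal_def)
  then have "(z - x) \<bullet> (z - x) = 0"
    by (simp add: inner_diff_left inner_diff_right inner_commute)
  then show "z = x" by simp
qed

section \<open>Smooth points of a convex polygon\<close>

lemma convex_polygonD:
  assumes "convex_polygon T"
  shows "polyhedron T" "convex T" "closed T" "interior T \<noteq> {}" "frontier T \<subseteq> T"
    "e edge_of T \<Longrightarrow> convex e" "e edge_of T \<Longrightarrow> e \<subseteq> frontier T"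
    "e edge_of T \<Longrightarrow> affine hull e \<inter> interior T = {}"
proof -
  show *: "polyhedron T" "convex T" "closed T" "interior T \<noteq> {}"
    using assms 
    by (auto simp: convex_polygon_def polytope_imp_polyhedron polytope_imp_convex polytope_imp_closed)
  then show "frontier T \<subseteq> T"
    by (simp add: frontier_subset_eq)
  assume e: "e edge_of T"
  then show "convex e"
    unfolding edge_of_def by (meson face_of_imp_convex)
  have "aff_dim T = 2"
    using * by (simp add: aff_dim_nonempty_interior)
  with e have "e \<noteq> T"
    unfolding edge_of_def by auto
  with e have "e \<inter> interior T = {}" "e \<subseteq> T"
    by (auto simp: edge_of_def dest: face_of_disjoint_interior face_of_imp_subset)
  then show "e \<subseteq> frontier T"
    unfolding frontier_def using closure_subset by fastforce
  show "affine hull e \<inter> interior T = {}"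
    using affine_hull_face_of_disjoint_rel_interior[of T e] * e \<open>e \<noteq> T\<close>
    by (simp add: edge_of_def rel_interior_nonempty_interior)
qed

text \<open>
  A linear functional attaining its maximum over an edge at a relatively interior point is constant
  on the edge. This is how a support vector at a smooth bounce point determines the edge line there.
\<close>

lemma edge_hyperplane:
  assumes T: "convex_polygon T" and e: "e edge_of T" "q \<in> rel_interior e"
    and v: "v \<noteq> 0" "\<And>x. x \<in> T \<Longrightarrow> (x - q) \<bullet> v \<le> 0"
  shows "affine hull e = {x. (x - q) \<bullet> v = 0}"
proof (rule is_line_eqI)
  show "is_line (affine hull e)"
    using e by (simp add: is_line_def edge_of_def)
  show line: "is_line {x. (x - q) \<bullet> v = 0}"
    by (rule is_line_hyperplane[OF v(1)])
  have "e \<subseteq> {x. (x - q) \<bullet> v = 0}"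
  proof
    fix x assume x: "x \<in> e"
    have "convex e" by (rule convex_polygonD[OF T]) fact
    \<comment> \<open>The segment from \<open>x\<close> to \<open>q\<close> can be prolonged beyond \<open>q\<close> inside \<open>e\<close>, to the other side of the
      hyperplane unless \<open>x\<close> lies on it.\<close>
    then obtain t where t: "t > 1" "(1 - t) *\<^sub>R x + t *\<^sub>R q \<in> e"
      using convex_rel_interior_if2[of e q] e(2) hull_inc[OF x] by blast
    have "e \<subseteq> T" using e(1) by (rule edge_of_imp_subset)
    have "((1 - t) *\<^sub>R x + t *\<^sub>R q - q) \<bullet> v \<le> 0"
      using v(2) t(2) \<open>e \<subseteq> T\<close> by blast
    also have "(1 - t) *\<^sub>R x + t *\<^sub>R q - q = (1 - t) *\<^sub>R (x - q)"
      by (simp add: algebra_simps)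
    finally have "(x - q) \<bullet> v \<ge> 0"
      using t(1) by (simp add: mult_le_0_iff)
    moreover have "(x - q) \<bullet> v \<le> 0"
      using v(2) x \<open>e \<subseteq> T\<close> by blast
    ultimately show "x \<in> {x. (x - q) \<bullet> v = 0}" by simp
  qed
  then show "affine hull e \<subseteq> {x. (x - q) \<bullet> v = 0}"
    using line by (intro hull_minimal) (auto simp: is_line_def)
qed

lemma support_disjoint_interior:
  fixes v :: plane
  assumes "v \<noteq> 0" "\<And>x. x \<in> T \<Longrightarrow> (x - q) \<bullet> v \<le> 0"
  shows "{x. (x - q) \<bullet> v = 0} \<inter> interior T = {}"
proof -
  have "T \<subseteq> {x. v \<bullet> x \<le> v \<bullet> q}"
    using assms(2) by (auto simp: inner_diff_eq)
  then have "interior T \<subseteq> {x. v \<bullet> x < v \<bullet> q}"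
    using interior_mono[of T] interior_halfspace_le[OF assms(1)] by blast
  then show ?thesis by (auto simp: inner_diff_eq)
qed

lemma smooth_point_frontier: "smooth_point T q \<Longrightarrow> q \<in> frontier T"
  by (simp add: smooth_point_def)

text \<open>
  A frontier point lies on some edge. It cannot be an end point of it: a vertex of the polygon has
  a supporting line that meets the polygon only there, besides the line through the edge.
\<close>

lemma smooth_point_imp_edge:
  assumes T: "convex_polygon T" and q: "smooth_point T q"
  obtains e where "e edge_of T" "q \<in> rel_interior e"
proof -
  note T' = convex_polygonD[OF T]
  have "rel_frontier T = frontier T"
    using T' by (simp add: rel_frontier_nonempty_interior)
  then have "q \<in> \<Union> {e. e facet_of T}"
    using q T'(1) unfolding smooth_point_def by (metis rel_frontier_of_polyhedron)
  then obtain e where e: "e facet_of T" "q \<in> e"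
    by blast
  have "aff_dim T = 2"
    using T' by (simp add: aff_dim_nonempty_interior)
  with e have edge: "e edge_of T"
    by (simp add: facet_of_def edge_of_def)
  have "q \<in> rel_interior e"
  proof (rule ccontr)
    assume "q \<notin> rel_interior e"
    with \<open>q \<in> e\<close> have "q \<in> rel_frontier e"
      unfolding rel_frontier_def using closure_subset by blast
    moreover have "polyhedron e"
      using T'(1) edge unfolding edge_of_def by (meson face_of_polyhedron_polyhedron)
    ultimately obtain F where F: "F facet_of e" "q \<in> F"
      by (auto simp: rel_frontier_of_polyhedron)
    then have "aff_dim F = 0"
      using edge by (simp add: facet_of_def edge_of_def)
    with F have "F = {q}"
      by (auto simp: aff_dim_eq_0)
    \<comment> \<open>An end point of an edge is a vertex, hence exposed: some supporting line \<open>M\<close> meets \<open>T\<close> in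
      \<open>q\<close> alone, so it differs from the line through the edge.\<close>
    with F edge have "{q} face_of T"
      unfolding facet_of_def edge_of_def using face_of_trans by blast
    then have "{q} exposed_face_of T"
      using T'(1) by (simp add: exposed_face_of_polyhedron)
    then obtain a b where ab: "T \<subseteq> {x. a \<bullet> x \<le> b}" "{q} = T \<inter> {x. a \<bullet> x = b}"
      unfolding exposed_face_of_def by auto
    have "T \<noteq> {q}"
      using \<open>aff_dim T = 2\<close> by auto
    have "q \<in> T \<inter> {x. a \<bullet> x = b}" using ab(2) by (metis singletonI)
    then have b: "b = a \<bullet> q" by simp
    have "a \<noteq> 0"
    proof
      assume "a = 0"
      then have "{x. a \<bullet> x = b} = UNIV" by (simp add: b)
      with ab(2) \<open>T \<noteq> {q}\<close> show False by simp
    qed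
    define M where "M = {x. (x - q) \<bullet> a = 0}"
    have M: "is_line M" "M \<inter> interior T = {}" "q \<in> M"
    proof -
      have "(x - q) \<bullet> a \<le> 0" if "x \<in> T" for x
        using ab(1) that unfolding b by (auto simp: inner_diff_eq)
      then show "M \<inter> interior T = {}"
        unfolding M_def by (rule support_disjoint_interior[OF \<open>a \<noteq> 0\<close>])
    qed (use is_line_hyperplane[OF \<open>a \<noteq> 0\<close>] in \<open>simp_all add: M_def\<close>)
    have N: "is_line (affine hull e)" "q \<in> affine hull e"
      using edge \<open>q \<in> e\<close> by (auto simp: is_line_def edge_of_def hull_inc)
    have "affine hull e = M"
      using q M N T'(8)[OF edge] unfolding smooth_point_def by blast
    have "e \<subseteq> {q}"
    proof
      fix x assume "x \<in> e"
      then have "x \<in> M" "x \<in> T"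
        using \<open>affine hull e = M\<close> edge_of_imp_subset[OF edge] hull_inc[of x e] by blast+
      then have "x \<in> T \<inter> {x. a \<bullet> x = b}"
        unfolding M_def b by (simp add: inner_diff_eq)
      then show "x \<in> {q}"
        using ab(2) by blast
    qed
    then have "aff_dim e \<le> 0"
      using aff_dim_subset[of e "{q}"] by simp
    with edge show False by (simp add: edge_of_def)
  qed
  with edge that show ?thesis by blast
qed

text \<open>
  The interior is connected, so a line that misses it has it on one side; the whole polygon is the closure of its interior.
\<close>

lemma line_avoiding_interior_supports:
  assumes T: "convex_polygon T" and L: "is_line L" "q \<in> L" "L \<inter> interior T = {}"
  obtains v where "v \<noteq> 0" "L = {x. (x - q) \<bullet> v = 0}" "\<And>x. x \<in> T \<Longrightarrow> (x - q) \<bullet> v \<le> 0"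
proof -
  note T' = convex_polygonD[OF T]
  obtain v where v: "v \<noteq> 0" "L = {x. (x - q) \<bullet> v = 0}"
    using line_normal_form[OF L(1,2)] by blast
  have conn: "connected (interior T)"
    using T'(2) by (intro convex_connected convex_interior)
  have side: "interior T \<subseteq> {x. v \<bullet> x \<le> v \<bullet> q} \<or> interior T \<subseteq> {x. v \<bullet> x \<ge> v \<bullet> q}"
  proof (rule ccontr)
    assume "\<not> ?thesis"
    then obtain x y where "x \<in> interior T" "\<not> v \<bullet> x \<le> v \<bullet> q" "y \<in> interior T" "\<not> v \<bullet> q \<le> v \<bullet> y"
      by blast
    then obtain z where "z \<in> interior T" "v \<bullet> z = v \<bullet> q"
      using connected_ivt_hyperplane[OF conn, of y x v "v \<bullet> q"] by auto
    then have "z \<in> L \<inter> interior T"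
      using v(2) by (simp add: inner_diff_eq)
    with L show False by blast
  qed
  have cl: "T \<subseteq> closure (interior T)"
    using convex_closure_interior[OF T'(2,4)] closure_subset by blast
  have "T \<subseteq> {x. v \<bullet> x \<le> v \<bullet> q} \<or> T \<subseteq> {x. v \<bullet> x \<ge> v \<bullet> q}"
    using side cl closure_minimal[of "interior T" "{x. v \<bullet> x \<le> v \<bullet> q}"]
      closure_minimal[of "interior T" "{x. v \<bullet> x \<ge> v \<bullet> q}"]
      closed_halfspace_le[of v "v \<bullet> q"] closed_halfspace_ge[of "v \<bullet> q" v] by blast
  then show ?thesis
  proof
    assume "T \<subseteq> {x. v \<bullet> x \<le> v \<bullet> q}"
    then have "(x - q) \<bullet> v \<le> 0" if "x \<in> T" for x
      using that by (auto simp: inner_diff_eq)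
    with v that show ?thesis by blast
  next
    assume "T \<subseteq> {x. v \<bullet> x \<ge> v \<bullet> q}"
    then have "(x - q) \<bullet> (- v) \<le> 0" if "x \<in> T" for x
      using that by (auto simp: inner_diff_eq)
    moreover have "- v \<noteq> 0" "L = {x. (x - q) \<bullet> (- v) = 0}"
      using v by simp_all
    ultimately show ?thesis using that by blast
  qed
qed

text \<open>
  Every line through the point that avoids the interior supports the polygon, hence is the edge line.
\<close>

lemma rel_interior_edge_smooth:
  assumes T: "convex_polygon T" and e: "e edge_of T" "q \<in> rel_interior e"
  shows "smooth_point T q"
  unfolding smooth_point_def
proof
  note T' = convex_polygonD[OF T]
  have "q \<in> e" using e(2) rel_interior_subset by blast
  then show "q \<in> frontier T" using T'(7)[OF e(1)] by blast
  show "\<exists>!L. is_line L \<and> q \<in> L \<and> L \<inter> interior T = {}"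
  proof
    show "is_line (affine hull e) \<and> q \<in> affine hull e \<and> affine hull e \<inter> interior T = {}"
      using e(1) \<open>q \<in> e\<close> T'(8) by (auto simp: is_line_def edge_of_def hull_inc)
  next
    fix L assume "is_line L \<and> q \<in> L \<and> L \<inter> interior T = {}"
    then obtain v where "v \<noteq> 0" "L = {x. (x - q) \<bullet> v = 0}" "\<And>x. x \<in> T \<Longrightarrow> (x - q) \<bullet> v \<le> 0"
      using line_avoiding_interior_supports[OF T] by blast
    with edge_hyperplane[OF T e] show "L = affine hull e" by metis
  qed
qed

section \<open>Triangles\<close>

lemma noncollinear_distinct:
  assumes "\<not> collinear {P, Q, R}"
  shows "P \<noteq> Q" "Q \<noteq> R" "R \<noteq> P"
  using assms by (auto simp: insert_commute)

lemma noncollinear_cyclic: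
  assumes "\<not> collinear {P, Q, R}"
  shows "\<not> collinear {Q, R, P}" "\<not> collinear {R, P, Q}"
  using assms by (metis insert_commute)+

lemma vertex_angle_less_pi_half:
  assumes "B \<noteq> A" "C \<noteq> A"
  shows "vertex_angle A B C < pi / 2 \<longleftrightarrow> (B - A) \<bullet> (C - A) > 0"
proof -
  define x where "x = ((B - A) \<bullet> (C - A)) / (norm (B - A) * norm (C - A))"
  have pos: "norm (B - A) * norm (C - A) > 0" using assms by simp
  have "\<bar>x\<bar> \<le> 1"
    using Cauchy_Schwarz_ineq2[of "B - A" "C - A"] pos by (simp add: x_def abs_mult)
  then have "arccos x < arccos 0 \<longleftrightarrow> 0 < x"
    by (intro arccos_less_mono) auto
  also have "0 < x \<longleftrightarrow> (B - A) \<bullet> (C - A) > 0"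
    unfolding x_def using pos by (simp add: zero_less_divide_iff)
  finally show ?thesis by (simp add: vertex_angle_def x_def)
qed

text \<open>
  All later estimates of angles use this form, free of arc cosines and lengths.
\<close>

lemma acute_triangle_iff:
  "acute_triangle A B C \<longleftrightarrow> \<not> collinear {A, B, C} \<and>
     (B - A) \<bullet> (C - A) > 0 \<and> (C - B) \<bullet> (A - B) > 0 \<and> (A - C) \<bullet> (B - C) > 0"
proof (cases "collinear {A, B, C}")
  case False
  note n = noncollinear_distinct[OF False]
  show ?thesis
    unfolding acute_triangle_def
    using vertex_angle_less_pi_half[of B A C] vertex_angle_less_pi_half[of C B A]
      vertex_angle_less_pi_half[of A C B] n by auto
qed (simp add: acute_triangle_def)

lemma triangle_sides_meet:
  fixes A B C :: plane
  assumes nc: "\<not> collinear {A, B, C}"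
  shows "affine hull {C, A} \<inter> affine hull {A, B} = {A}"
proof
  note n = noncollinear_distinct[OF nc]
  show "affine hull {C, A} \<inter> affine hull {A, B} \<subseteq> {A}"
  proof
    fix x assume x: "x \<in> affine hull {C, A} \<inter> affine hull {A, B}"
    show "x \<in> {A}"
    proof (rule ccontr)
      assume "x \<notin> {A}"
      then have "affine hull {A, x} = L" if "is_line L" "A \<in> L" "x \<in> L" for L
        using affine_hull_2_eq_line[OF that] by simp
      from this[of "affine hull {C, A}"] this[of "affine hull {A, B}"]
      have "affine hull {A, x} = affine hull {C, A}" "affine hull {A, x} = affine hull {A, B}"
        using x n by (simp_all add: is_line_affine_hull_2 hull_inc)
      then have "C \<in> affine hull {A, B}"
        using hull_inc[of C "{C, A}" affine] by simp
      then show False using nc affine_hull_3_imp_collinear by blast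
    qed
  qed
qed (simp add: hull_inc)

section \<open>Bisectors and the excentral triangle\<close>

text \<open>
  The vector of the reflection law at \<open>P\<close>. If the points are not collinear, it points along
  the bisector of the angle \<open>QPR\<close>, away from the triangle, so the line orthogonal to it at \<open>P\<close> is the external bisector.
\<close>

definition bounce_vector :: "'a::real_normed_vector \<Rightarrow> 'a \<Rightarrow> 'a \<Rightarrow> 'a" where
  "bounce_vector P Q R = (P - Q) /\<^sub>R norm (P - Q) + (P - R) /\<^sub>R norm (P - R)"

lemma bounce_vector_commute: "bounce_vector P Q R = bounce_vector P R Q"
  by (simp add: bounce_vector_def add.commute)

text \<open>
  The excenter of the triangle \<open>PQR\<close> opposite to \<open>P\<close>, by its barycentric coordinates \<open>(-p : q : r)\<close>,
  where \<open>p\<close>, \<open>q\<close>, \<open>r\<close> are the lengths of the sides opposite to \<open>P\<close>, \<open>Q\<close>, \<open>R\<close>.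
\<close>

definition excenter :: "'a::real_normed_vector \<Rightarrow> 'a \<Rightarrow> 'a \<Rightarrow> 'a" where
  "excenter P Q R =
     (dist P R *\<^sub>R Q + dist P Q *\<^sub>R R - dist Q R *\<^sub>R P) /\<^sub>R (dist P R + dist P Q - dist Q R)"

lemma noncollinear_triangle_ineq:
  fixes P Q R :: "'a::euclidean_space"
  assumes "\<not> collinear {P, Q, R}"
  shows "dist Q R < dist P R + dist P Q"
proof -
  have "\<not> between (Q, R) P"
    using assms by (simp add: collinear_between_cases)
  then show ?thesis
    using dist_triangle[of Q R P] unfolding between by (simp add: dist_commute)
qed

lemma excenter_diff:
  fixes P Q R :: "'a::euclidean_space"
  assumes "\<not> collinear {P, Q, R}"
  defines "s \<equiv> dist P R + dist P Q - dist Q R"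
  shows "s > 0"
    and "s *\<^sub>R (excenter P Q R - P) = dist P R *\<^sub>R (Q - P) + dist P Q *\<^sub>R (R - P)"
    and "s *\<^sub>R (excenter P Q R - Q) = dist P Q *\<^sub>R (R - Q) - dist Q R *\<^sub>R (P - Q)"
    and "s *\<^sub>R (excenter P Q R - R) = dist P R *\<^sub>R (Q - R) - dist Q R *\<^sub>R (P - R)"
proof -
  show s: "s > 0"
    using noncollinear_triangle_ineq[OF assms(1)] by (simp add: s_def)
  have "s *\<^sub>R excenter P Q R = dist P R *\<^sub>R Q + dist P Q *\<^sub>R R - dist Q R *\<^sub>R P"
    unfolding excenter_def s_def[symmetric] using s by simp
  then have *: "s *\<^sub>R (excenter P Q R - X) = dist P R *\<^sub>R Q + dist P Q *\<^sub>R R - dist Q R *\<^sub>R P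
      - (dist P R + dist P Q - dist Q R) *\<^sub>R X" for X
    unfolding s_def by (simp add: scaleR_diff_right)
  show "s *\<^sub>R (excenter P Q R - P) = dist P R *\<^sub>R (Q - P) + dist P Q *\<^sub>R (R - P)"
    "s *\<^sub>R (excenter P Q R - Q) = dist P Q *\<^sub>R (R - Q) - dist Q R *\<^sub>R (P - Q)"
    "s *\<^sub>R (excenter P Q R - R) = dist P R *\<^sub>R (Q - R) - dist Q R *\<^sub>R (P - R)"
    unfolding * by (simp_all add: algebra_simps)
qed

text \<open>
  The diagonals of a rhombus are orthogonal, here for the rhombus spanned by the unit vectors of
  \<open>u\<close> and \<open>w\<close>: this is why internal and external bisectors are orthogonal.
\<close>

lemma norm_scaled_diff_orthogonal:
  fixes u w :: "'a::real_inner"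
  assumes "u \<noteq> 0" "w \<noteq> 0"
  shows "(norm u *\<^sub>R w - norm w *\<^sub>R u) \<bullet> (w /\<^sub>R norm w + u /\<^sub>R norm u) = 0"
  using assms
  by (simp add: inner_diff_left inner_diff_right inner_add_right dot_square_norm power2_eq_square inner_commute field_simps)

lemma bounce_vector_inner_zero:
  fixes P Q R X :: "'a::real_inner"
  assumes "Q \<noteq> P" "Q \<noteq> R" "s > 0"
    and "s *\<^sub>R (X - Q) = norm (P - Q) *\<^sub>R (R - Q) - norm (R - Q) *\<^sub>R (P - Q)"
  shows "(X - Q) \<bullet> bounce_vector Q R P = 0"
proof -
  have b: "bounce_vector Q R P = - ((R - Q) /\<^sub>R norm (R - Q) + (P - Q) /\<^sub>R norm (P - Q))"
    by (simp add: bounce_vector_def norm_minus_commute algebra_simps)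
  have "s *\<^sub>R (X - Q) \<bullet> bounce_vector Q R P = 0"
    unfolding inner_scaleR_left[symmetric] assms(4) b inner_minus_right
    using norm_scaled_diff_orthogonal[of "P - Q" "R - Q"] assms by simp
  then show ?thesis using assms(3) by simp
qed

text \<open>
  The line orthogonal to the bounce vector at \<open>Q\<close> is the external bisector at \<open>Q\<close>, and likewise at \<open>R\<close>;
  these two meet in the excenter opposite to \<open>P\<close>.
\<close>

lemma excenter_on_bisectors:
  fixes P Q R :: "'a::euclidean_space"
  assumes "\<not> collinear {P, Q, R}"
  shows "(excenter P Q R - Q) \<bullet> bounce_vector Q R P = 0"
    and "(excenter P Q R - R) \<bullet> bounce_vector R P Q = 0"
proof -
  note d = excenter_diff[OF assms] and n = noncollinear_distinct[OF assms]
  show "(excenter P Q R - Q) \<bullet> bounce_vector Q R P = 0"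
    using d(3) n by (intro bounce_vector_inner_zero[OF _ _ d(1)]) (auto simp: dist_norm norm_minus_commute)
  have "(excenter P Q R - R) \<bullet> bounce_vector R Q P = 0"
    using d(4) n by (intro bounce_vector_inner_zero[OF _ _ d(1)]) (auto simp: dist_norm norm_minus_commute)
  then show "(excenter P Q R - R) \<bullet> bounce_vector R P Q = 0"
    by (simp add: bounce_vector_commute)
qed

text \<open>
  The excenter opposite to \<open>P\<close> lies on the internal bisector at \<open>P\<close>, on the side of the triangle. Hence
  this bisector is an altitude of the excentral triangle.
\<close>

lemma excenter_bounce_vector:
  fixes P Q R :: "'a::euclidean_space"
  assumes "\<not> collinear {P, Q, R}"
  obtains k where "k > 0" "excenter P Q R - P = - k *\<^sub>R bounce_vector P Q R"
proof
  define s where "s = dist P R + dist P Q - dist Q R"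
  note d = excenter_diff[OF assms, folded s_def] and n = noncollinear_distinct[OF assms]
  let ?k = "dist P Q * dist P R / s"
  show "?k > 0" using d(1) n by simp
  have "(dist P Q * dist P R) *\<^sub>R bounce_vector P Q R
      = dist P R *\<^sub>R (P - Q) + dist P Q *\<^sub>R (P - R)"
  proof -
    have cancel: "x * y * inverse x = y" "y * x * inverse x = y" if "x \<noteq> 0" for x y :: real
      using that by simp_all
    then show ?thesis
      using n by (simp add: bounce_vector_def dist_norm scaleR_add_right cancel)
  qed
  then have "s *\<^sub>R (excenter P Q R - P) = s *\<^sub>R (- ?k *\<^sub>R bounce_vector P Q R)"
    unfolding d(2) using d(1) by (simp add: algebra_simps)
  then show "excenter P Q R - P = - ?k *\<^sub>R bounce_vector P Q R"
    using d(1) by (simp only: scaleR_cancel_left) simp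
qed

lemma excenter_neq:
  fixes P Q R :: "'a::euclidean_space"
  assumes "\<not> collinear {P, Q, R}"
  shows "excenter P Q R \<noteq> P" "excenter P Q R \<noteq> Q"
proof -
  note d = excenter_diff[OF assms] and n = noncollinear_distinct[OF assms]
  have aux: False if "c \<noteq> 0" "c *\<^sub>R (Y - X) = e *\<^sub>R (Z - X)" "{X, Y, Z} = {P, Q, R}" for X Y Z :: 'a and c e
  proof -
    have "inverse c *\<^sub>R c *\<^sub>R (Y - X) = inverse c *\<^sub>R e *\<^sub>R (Z - X)"
      by (simp only: that(2))
    then have "Y - X = (e / c) *\<^sub>R (Z - X)"
      using that(1) by (simp add: divide_inverse mult.commute)
    then have "collinear {0, Z - X, Y - X}"
      unfolding collinear_lemma by blast
    then have "collinear {Z, X, Y}"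
      using collinear_3[of Z X Y] by simp
    with that(3) assms show False by (metis insert_commute)
  qed
  show "excenter P Q R \<noteq> P"
  proof
    assume "excenter P Q R = P"
    with d(2) have "dist P R *\<^sub>R (Q - P) = (- dist P Q) *\<^sub>R (R - P)"
      by (simp add: eq_neg_iff_add_eq_0)
    then show False
      by (rule aux[rotated]) (use n in auto)
  qed
  show "excenter P Q R \<noteq> Q"
  proof
    assume "excenter P Q R = Q"
    with d(3) have "dist P Q *\<^sub>R (R - Q) = dist Q R *\<^sub>R (P - Q)"
      by simp
    then show False
      by (rule aux[rotated]) (use n in auto)
  qed
qed

text \<open>
  The foot of each altitude of the excentral triangle lies strictly inside the opposite side, which makes
  both adjacent angles acute. One angle suffices, by cyclic symmetry.
\<close>

lemma excenter_angle:
  fixes P Q R :: "'a::euclidean_space"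
  assumes nc: "\<not> collinear {P, Q, R}"
  shows "(excenter Q R P - excenter P Q R) \<bullet> (excenter R P Q - excenter P Q R) > 0"
proof -
  have nc': "\<not> collinear {R, P, Q}" "\<not> collinear {Q, R, P}"
    using nc by (metis insert_commute)+
  define A B C where "A = excenter P Q R" "B = excenter Q R P" "C = excenter R P Q"
  define D where "D = dist P Q *\<^sub>R (R - Q) - dist Q R *\<^sub>R (P - Q)"
  \<comment> \<open>The altitude from \<open>B\<close> has its foot at \<open>Q\<close>, so \<open>B\<close> may be replaced by \<open>Q\<close> in the inner product;
    and \<open>Q\<close> lies strictly between \<open>A\<close> and \<open>C\<close>, since \<open>A - Q\<close> and \<open>C - Q\<close> are opposite multiples of \<open>D\<close>.\<close>
  obtain k where "B - Q = - k *\<^sub>R bounce_vector Q R P"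
    using excenter_bounce_vector[OF nc'(2)] unfolding A_B_C_def by metis
  moreover have "(C - A) \<bullet> bounce_vector Q R P = 0"
    using excenter_on_bisectors(1)[OF nc] excenter_on_bisectors(2)[OF nc'(1)]
    unfolding A_B_C_def by (simp add: inner_diff_left)
  ultimately have "(B - Q) \<bullet> (C - A) = 0"
    by (simp add: inner_commute)
  then have eq: "(B - A) \<bullet> (C - A) = (Q - A) \<bullet> (C - A)"
    by (simp add: inner_diff_left)
  obtain s where s: "s > 0" "s *\<^sub>R (A - Q) = D"
    using excenter_diff(1,3)[OF nc] unfolding A_B_C_def D_def by blast
  obtain t where t: "t > 0" "t *\<^sub>R (C - Q) = - D"
  proof (rule that)
    show "dist R Q + dist R P - dist P Q > 0"
      by (rule excenter_diff(1)[OF nc'(1)])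
    show "(dist R Q + dist R P - dist P Q) *\<^sub>R (C - Q) = - D"
      unfolding A_B_C_def D_def excenter_diff(4)[OF nc'(1)] by (simp add: dist_commute)
  qed
  have A: "A - Q = D /\<^sub>R s" using s by (metis less_irrefl scaleR_left_imp_eq scaleR_scaleR right_inverse scaleR_one)
  have C: "C - Q = - (D /\<^sub>R t)" using t by (metis less_irrefl scaleR_left_imp_eq scaleR_scaleR right_inverse scaleR_one scaleR_minus_right)
  have "D \<noteq> 0" using A excenter_neq(2)[OF nc] unfolding A_B_C_def by auto
  have "Q - A = - (inverse s *\<^sub>R D)" "C - A = - ((inverse s + inverse t) *\<^sub>R D)"
    using A C by (simp_all add: algebra_simps)
  then have "(Q - A) \<bullet> (C - A) = inverse s * (inverse s + inverse t) * (D \<bullet> D)"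
    by simp
  also have "\<dots> > 0"
    using s t \<open>D \<noteq> 0\<close> by (simp add: add_pos_pos)
  finally show ?thesis
    using eq unfolding A_B_C_def by simp
qed

text \<open>
  The line of the bounce at \<open>P\<close> passes through the other two excenters, so it carries a side of the
  excentral triangle.
\<close>

lemma excenter_line:
  fixes P Q R :: plane
  assumes nc: "\<not> collinear {P, Q, R}"
  shows "affine hull {excenter Q R P, excenter R P Q} = {x. (x - P) \<bullet> bounce_vector P Q R = 0}"
proof (rule affine_hull_2_eq_line)
  note nc' = noncollinear_cyclic[OF nc]
  have "bounce_vector P Q R \<noteq> 0"
    using excenter_bounce_vector[OF nc] excenter_neq(1)[OF nc] by force
  then show "is_line {x. (x - P) \<bullet> bounce_vector P Q R = 0}"
    by (rule is_line_hyperplane)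
  show "excenter Q R P \<in> {x. (x - P) \<bullet> bounce_vector P Q R = 0}"
    using excenter_on_bisectors(2)[OF nc'(1)] by simp
  show "excenter R P Q \<in> {x. (x - P) \<bullet> bounce_vector P Q R = 0}"
    using excenter_on_bisectors(1)[OF nc'(2)] by simp
  show "excenter Q R P \<noteq> excenter R P Q"
    using excenter_angle[OF nc'(1)] by auto
qed

lemma excenter_projection:
  fixes P Q R :: plane
  assumes nc: "\<not> collinear {P, Q, R}"
  shows "orthogonal_projection (affine hull {excenter Q R P, excenter R P Q}) (excenter P Q R) = P"
proof (rule orthogonal_projection_eqI)
  show "P \<in> affine hull {excenter Q R P, excenter R P Q}"
    unfolding excenter_line[OF nc] by simp
  fix y assume "y \<in> affine hull {excenter Q R P, excenter R P Q}"
  then have "(y - P) \<bullet> bounce_vector P Q R = 0"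
    unfolding excenter_line[OF nc] by simp
  moreover obtain k where "excenter P Q R - P = - k *\<^sub>R bounce_vector P Q R"
    using excenter_bounce_vector[OF nc] by blast
  ultimately show "(excenter P Q R - P) \<bullet> (y - P) = 0"
    by (simp add: inner_commute)
qed

text \<open>
  Since \<open>P\<close>, \<open>Q\<close>, \<open>R\<close> lie on the side lines, the excenters cannot be collinear unless \<open>P\<close>, \<open>Q\<close>, \<open>R\<close> are.
\<close>

lemma excentral_acute:
  fixes P Q R :: plane
  assumes nc: "\<not> collinear {P, Q, R}"
  shows "acute_triangle (excenter P Q R) (excenter Q R P) (excenter R P Q)"
proof -
  note nc' = noncollinear_cyclic[OF nc]
  let ?A = "excenter P Q R" and ?B = "excenter Q R P" and ?C = "excenter R P Q"
  have "\<not> collinear {?A, ?B, ?C}"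
  proof
    assume "collinear {?A, ?B, ?C}"
    then have "collinear (affine hull {?A, ?B, ?C})"
      by (simp add: collinear_affine_hull_collinear)
    moreover have "P \<in> affine hull {?B, ?C}" "Q \<in> affine hull {?C, ?A}" "R \<in> affine hull {?A, ?B}"
      using excenter_line[OF nc] excenter_line[OF nc'(1)] excenter_line[OF nc'(2)] by simp_all
    then have "{P, Q, R} \<subseteq> affine hull {?A, ?B, ?C}"
      using hull_mono[of "{?B, ?C}" "{?A, ?B, ?C}" affine] hull_mono[of "{?C, ?A}" "{?A, ?B, ?C}" affine]
        hull_mono[of "{?A, ?B}" "{?A, ?B, ?C}" affine] by auto
    ultimately show False
      using nc collinear_subset by blast
  qed
  then show ?thesis
    unfolding acute_triangle_iff
    using excenter_angle[OF nc] excenter_angle[OF nc'(1)] excenter_angle[OF nc'(2)] by blast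
qed

text \<open>
  The three half-planes of the support conditions cut out the excentral triangle; this gives the
  inclusion of the polygon in the triangle.
\<close>

lemma excentral_hull:
  fixes P Q R :: plane
  assumes nc: "\<not> collinear {P, Q, R}"
    and x: "(x - P) \<bullet> bounce_vector P Q R \<le> 0" "(x - Q) \<bullet> bounce_vector Q R P \<le> 0"
      "(x - R) \<bullet> bounce_vector R P Q \<le> 0"
  shows "x \<in> convex hull {excenter P Q R, excenter Q R P, excenter R P Q}"
proof -
  note nc' = noncollinear_cyclic[OF nc]
  let ?A = "excenter P Q R" and ?B = "excenter Q R P" and ?C = "excenter R P Q"
  have "\<not> collinear {?A, ?B, ?C}"
    using excentral_acute[OF nc] unfolding acute_triangle_def by blast
  then have "aff_dim {?A, ?B, ?C} = int DIM(plane)"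
    using aff_dim_le_DIM[of "{?A, ?B, ?C}"] unfolding collinear_aff_dim by simp
  then have "x \<in> affine hull {?A, ?B, ?C}"
    unfolding aff_dim_eq_full by simp
  then obtain \<alpha> \<beta> \<gamma> where w: "\<alpha> + \<beta> + \<gamma> = 1" "x = \<alpha> *\<^sub>R ?A + \<beta> *\<^sub>R ?B + \<gamma> *\<^sub>R ?C"
    unfolding affine_hull_3 by blast
  \<comment> \<open>Pairing with the bounce vector at a vertex kills the contributions of the two excenters on the
    bisector there, so the inequality is the sign of the remaining barycentric coordinate.\<close>
  have weight: "\<xi> \<ge> 0"
    if nc: "\<not> collinear {X, Y, Z}" and sum: "\<xi> + \<eta> + \<zeta> = 1"
      and eq: "x = \<xi> *\<^sub>R excenter X Y Z + \<eta> *\<^sub>R excenter Y Z X + \<zeta> *\<^sub>R excenter Z X Y"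
      and le: "(x - X) \<bullet> bounce_vector X Y Z \<le> 0" for X Y Z :: plane and \<xi> \<eta> \<zeta>
  proof -
    let ?v = "bounce_vector X Y Z"
    obtain k where k: "k > 0" "excenter X Y Z - X = - k *\<^sub>R ?v"
      using excenter_bounce_vector[OF nc] by blast
    have "x - X = x - (\<xi> + \<eta> + \<zeta>) *\<^sub>R X" by (simp add: sum)
    also have "\<dots> = \<xi> *\<^sub>R (excenter X Y Z - X) + \<eta> *\<^sub>R (excenter Y Z X - X) + \<zeta> *\<^sub>R (excenter Z X Y - X)"
      unfolding eq by (simp add: algebra_simps)
    finally have "(x - X) \<bullet> ?v = \<xi> * ((excenter X Y Z - X) \<bullet> ?v)"
      using excenter_on_bisectors(2)[OF noncollinear_cyclic(1)[OF nc]]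
        excenter_on_bisectors(1)[OF noncollinear_cyclic(2)[OF nc]]
      by (simp add: inner_add_left)
    with le have "0 \<le> \<xi> * (k * (?v \<bullet> ?v))"
      unfolding k(2) by simp
    moreover have "?v \<noteq> 0"
      using k(2) excenter_neq(1)[OF nc] by auto
    then have "k * (?v \<bullet> ?v) > 0"
      using k(1) by simp
    ultimately show ?thesis
      by (simp only: zero_le_mult_iff) linarith
  qed
  have "\<alpha> \<ge> 0" by (rule weight[OF nc w x(1)])
  moreover have "\<beta> \<ge> 0"
    by (rule weight[OF nc'(1) _ _ x(2), of \<beta> \<gamma> \<alpha>]) (use w in \<open>simp_all add: add_ac\<close>)
  moreover have "\<gamma> \<ge> 0"
    by (rule weight[OF nc'(2) _ _ x(3), of \<gamma> \<alpha> \<beta>]) (use w in \<open>simp_all add: add_ac\<close>)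
  ultimately show ?thesis
    unfolding convex_hull_3 using w by blast
qed

section \<open>Altitudes of an acute triangle\<close>

lemma foot_on_line:
  fixes A X Y Z :: "'a::real_inner"
  assumes "X \<in> affine hull {A, Z}" "(Y - X) \<bullet> (Z - A) = 0"
  shows "X - A = ((Y - A) \<bullet> (Z - A) / ((Z - A) \<bullet> (Z - A))) *\<^sub>R (Z - A)"
proof -
  obtain y where "X = A + y *\<^sub>R (Z - A)"
    using assms(1) by (auto simp: affine_hull_2_alt)
  then have y: "X - A = y *\<^sub>R (Z - A)" by simp
  have "(X - A) \<bullet> (Z - A) = (Y - A) \<bullet> (Z - A)"
    using assms(2) by (simp add: inner_diff_left)
  then show ?thesis unfolding y by (cases "Z = A") (auto simp: eq_divide_eq)
qed

text \<open>
  The altitudes of an acute triangle bisect the angles of its orthic triangle, so the bounce vector at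
  a foot is an outward normal of the side. One foot suffices, as the hypotheses are cyclic.
\<close>

lemma orthic_bounce_vector:
  fixes A B C P Q R :: "'a::real_inner"
  assumes acute: "(B - A) \<bullet> (C - A) > 0" "(C - B) \<bullet> (A - B) > 0" "(A - C) \<bullet> (B - C) > 0"
    and P: "P \<in> affine hull {B, C}" "(A - P) \<bullet> (C - B) = 0"
    and Q: "Q \<in> affine hull {C, A}" "(B - Q) \<bullet> (A - C) = 0"
    and R: "R \<in> affine hull {A, B}" "(C - R) \<bullet> (B - A) = 0"
  shows "P \<noteq> Q" and "\<exists>k\<ge>0. bounce_vector P Q R = k *\<^sub>R (P - A)"
proof -
  \<comment> \<open>Everything is computed in the basis \<open>u\<close>, \<open>v\<close> with origin \<open>A\<close>; acuteness makes \<open>d\<close>, \<open>b - d\<close> and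
    \<open>c - d\<close> positive, and \<open>s\<close> is the square of the length of \<open>BC\<close>.\<close>
  define u v where "u = B - A" "v = C - A"
  define b c d s where "b = v \<bullet> v" "c = u \<bullet> u" "d = u \<bullet> v" "s = b + c - 2 * d"
  note defs = b_c_d_s_def
  have vu: "v \<bullet> u = d" by (simp add: defs inner_commute)
  have B: "B = A + u" and C: "C = A + v" by (simp_all add: u_v_def)
  have dp: "d > 0" and bp: "b - d > 0" and cp: "c - d > 0"
    using acute unfolding B C by (simp_all add: defs inner_diff_left inner_diff_right inner_commute)
  then have b: "b > 0" and c: "c > 0" by simp_all
  have s: "s > 0" using bp cp by (simp add: defs)
  obtain t where "P = B + t *\<^sub>R (C - B)"
    using P(1) by (auto simp: affine_hull_2_alt)
  then have P1: "P - A = (1 - t) *\<^sub>R u + t *\<^sub>R v"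
    unfolding B C by (simp add: algebra_simps)
  have "(P - A) \<bullet> (v - u) = 0"
    using P(2) by (simp add: B C inner_diff_left)
  then have "t * s = c - d"
    unfolding P1 by (simp add: inner_add_left inner_diff_right vu flip: b_c_d_s_def(1-3)) (simp add: defs(4) algebra_simps)
  then have t: "t = (c - d) / s" using s by (simp add: field_simps)
  have P': "P - A = ((b - d) / s) *\<^sub>R u + ((c - d) / s) *\<^sub>R v"
  proof -
    have "1 - t = (b - d) / s"
      using s unfolding t by (simp add: defs(4) field_simps)
    then show ?thesis unfolding P1 by (simp add: t)
  qed
  have Q': "Q - A = (d / b) *\<^sub>R v"
    using foot_on_line[of Q A C B] Q by (simp add: insert_commute inner_diff_right defs u_v_def)
  have R': "R - A = (d / c) *\<^sub>R u"
    using foot_on_line[of R A B C] R by (simp add: inner_diff_right defs u_v_def inner_commute)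
  \<comment> \<open>\<open>P - Q\<close> and \<open>P - R\<close> are positive multiples of two vectors of the same length \<open>N\<close>, whose sum is
    a multiple of \<open>P - A\<close>.\<close>
  define N where "N = sqrt (s * b * c)"
  have N: "N > 0" using s b c by (simp add: N_def)
  have "norm (b *\<^sub>R u + (c - 2 * d) *\<^sub>R v) = N"
    unfolding N_def norm_eq_sqrt_inner
    by (simp add: inner_add_left inner_add_right vu flip: b_c_d_s_def(1-3)) (simp add: defs(4) algebra_simps)
  moreover have "norm (c *\<^sub>R v + (b - 2 * d) *\<^sub>R u) = N"
    unfolding N_def norm_eq_sqrt_inner
    by (simp add: inner_add_left inner_add_right vu flip: b_c_d_s_def(1-3)) (simp add: defs(4) algebra_simps)
  moreover have PQ: "P - Q = ((b - d) / (s * b)) *\<^sub>R (b *\<^sub>R u + (c - 2 * d) *\<^sub>R v)"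
  proof -
    have "P - Q = ((b - d) / s) *\<^sub>R u + ((c - d) / s - d / b) *\<^sub>R v"
      using P' Q' by (simp add: algebra_simps)
    also have "(c - d) / s - d / b = (b - d) * (c - 2 * d) / (s * b)"
      using s b by (simp add: divide_simps) (simp add: defs(4) algebra_simps)
    finally show ?thesis using b by (simp add: scaleR_add_right)
  qed
  moreover have PR: "P - R = ((c - d) / (s * c)) *\<^sub>R (c *\<^sub>R v + (b - 2 * d) *\<^sub>R u)"
  proof -
    have "P - R = ((c - d) / s) *\<^sub>R v + ((b - d) / s - d / c) *\<^sub>R u"
      using P' R' by (simp add: algebra_simps)
    also have "(b - d) / s - d / c = (c - d) * (b - 2 * d) / (s * c)"
      using s c by (simp add: divide_simps) (simp add: defs(4) algebra_simps)
    finally show ?thesis using c by (simp add: scaleR_add_right)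
  qed
  ultimately have n: "norm (P - Q) = (b - d) / (s * b) * N" "norm (P - R) = (c - d) / (s * c) * N"
    using bp cp s b c by simp_all
  show "P \<noteq> Q"
    using n(1) bp s b N by auto
  have normalise: "(k *\<^sub>R X) /\<^sub>R (k * N) = X /\<^sub>R N" if "k > 0" for k and X :: 'a
    using that by (simp add: field_simps)
  have "bounce_vector P Q R
      = (b *\<^sub>R u + (c - 2 * d) *\<^sub>R v) /\<^sub>R N + (c *\<^sub>R v + (b - 2 * d) *\<^sub>R u) /\<^sub>R N"
    unfolding bounce_vector_def n unfolding PQ PR
    using bp cp s b c by (simp only: normalise zero_less_divide_iff zero_less_mult_iff simp_thms)
  also have "\<dots> = (2 / N) *\<^sub>R ((b - d) *\<^sub>R u + (c - d) *\<^sub>R v)"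
  proof -
    have "(b *\<^sub>R u + (c - 2 * d) *\<^sub>R v) + (c *\<^sub>R v + (b - 2 * d) *\<^sub>R u)
        = (b + (b - 2 * d)) *\<^sub>R u + (c + (c - 2 * d)) *\<^sub>R v"
      by (simp only: scaleR_add_left add_ac)
    also have "b + (b - 2 * d) = 2 * (b - d)" by simp
    also have "c + (c - 2 * d) = 2 * (c - d)" by simp
    also have "(2 * (b - d)) *\<^sub>R u + (2 * (c - d)) *\<^sub>R v
        = 2 *\<^sub>R ((b - d) *\<^sub>R u + (c - d) *\<^sub>R v)"
      by (simp add: scaleR_add_right)
    finally show ?thesis
      unfolding scaleR_add_right[symmetric] by (simp only: scaleR_scaleR divide_inverse mult.commute)
  qed
  also have "(b - d) *\<^sub>R u + (c - d) *\<^sub>R v = s *\<^sub>R (P - A)"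
    unfolding P' using s by (simp add: scaleR_add_right)
  finally have "bounce_vector P Q R = (2 / N * s) *\<^sub>R (P - A)"
    by simp
  then show "\<exists>k\<ge>0. bounce_vector P Q R = k *\<^sub>R (P - A)"
    using N s by (intro exI[of _ "2 / N * s"]) simp
qed

lemma foot_of_altitude:
  fixes A B C :: plane
  assumes "B \<noteq> C"
  defines "P \<equiv> orthogonal_projection (affine hull {B, C}) A"
  shows "P \<in> affine hull {B, C}" "(A - P) \<bullet> (C - B) = 0"
proof -
  define t where "t = (A - B) \<bullet> (C - B) / ((C - B) \<bullet> (C - B))"
  define X where "X = B + t *\<^sub>R (C - B)"
  have X: "X \<in> affine hull {B, C}" "(A - X) \<bullet> (C - B) = 0"
  proof -
    show "X \<in> affine hull {B, C}"
      unfolding affine_hull_2_alt X_def by (rule rangeI)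
    have "A - X = (A - B) - t *\<^sub>R (C - B)" by (simp add: X_def)
    then have "(A - X) \<bullet> (C - B) = (A - B) \<bullet> (C - B) - t * ((C - B) \<bullet> (C - B))"
      by (simp only: inner_diff_left inner_scaleR_left)
    then show "(A - X) \<bullet> (C - B) = 0"
      using assms(1) by (simp add: t_def)
  qed
  have "P = X"
    unfolding P_def
  proof (rule orthogonal_projection_eqI[OF X(1)])
    fix y assume "y \<in> affine hull {B, C}"
    then obtain r where "y = B + r *\<^sub>R (C - B)"
      unfolding affine_hull_2_alt by blast
    then have "y - X = (r - t) *\<^sub>R (C - B)"
      by (simp add: X_def algebra_simps)
    then show "(A - X) \<bullet> (y - X) = 0" using X(2) by simp
  qed
  with X show "P \<in> affine hull {B, C}" "(A - P) \<bullet> (C - B) = 0" by simp_all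
qed

text \<open>
  It suffices to look at the vertices: the inner product vanishes at \<open>B\<close> and \<open>C\<close>, and at \<open>A\<close> it is minus
  the square of the altitude.
\<close>

lemma triangle_below_side:
  fixes A B C P :: "'a::euclidean_space"
  assumes P: "P \<in> affine hull {B, C}" "(A - P) \<bullet> (C - B) = 0" and x: "x \<in> convex hull {A, B, C}"
  shows "(x - P) \<bullet> (P - A) \<le> 0"
proof -
  obtain t where t: "P = B + t *\<^sub>R (C - B)"
    using P(1) unfolding affine_hull_2_alt by blast
  have orth: "(C - B) \<bullet> (P - A) = 0"
    using P(2) by (simp add: inner_diff_left inner_diff_right inner_commute)
  have "B - P = (- t) *\<^sub>R (C - B)" "C - P = (1 - t) *\<^sub>R (C - B)"
    by (simp_all add: t algebra_simps)
  then have "(B - P) \<bullet> (P - A) = 0" "(C - P) \<bullet> (P - A) = 0"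
    using orth by simp_all
  moreover have "(A - P) \<bullet> (P - A) \<le> 0"
    using inner_ge_zero[of "P - A"] by (simp add: inner_diff_left)
  ultimately have "{A, B, C} \<subseteq> {y. (P - A) \<bullet> y \<le> (P - A) \<bullet> P}"
    by (simp add: inner_diff_eq)
  then have "convex hull {A, B, C} \<subseteq> {y. (P - A) \<bullet> y \<le> (P - A) \<bullet> P}"
    by (rule hull_minimal) (rule convex_halfspace_le)
  with x show ?thesis by (auto simp: inner_diff_eq)
qed

lemma foot_bounce_support:
  assumes T: "convex_polygon T" "T \<subseteq> convex hull {A, B, C}"
    and acute: "acute_triangle A B C"
    and P: "P \<in> affine hull {B, C}" "(A - P) \<bullet> (C - B) = 0" "smooth_point T P"
    and Q: "Q \<in> affine hull {C, A}" "(B - Q) \<bullet> (A - C) = 0"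
    and R: "R \<in> affine hull {A, B}" "(C - R) \<bullet> (B - A) = 0"
  shows "P \<noteq> Q" "outward_support_vector T P (bounce_vector P Q R)"
proof -
  have ac: "(B - A) \<bullet> (C - A) > 0" "(C - B) \<bullet> (A - B) > 0" "(A - C) \<bullet> (B - C) > 0"
    using acute unfolding acute_triangle_iff by blast+
  note orthic = orthic_bounce_vector[OF ac P(1,2) Q R]
  show "P \<noteq> Q" by (rule orthic(1))
  obtain k where k: "k \<ge> 0" "bounce_vector P Q R = k *\<^sub>R (P - A)"
    using orthic(2) by blast
  have "(x - P) \<bullet> bounce_vector P Q R \<le> 0" if "x \<in> T" for x
    using triangle_below_side[OF P(1,2), of x] that T(2) k by (auto simp: mult_nonneg_nonpos)
  then show "outward_support_vector T P (bounce_vector P Q R)"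
    unfolding outward_support_vector_def using smooth_point_frontier[OF P(3)] by blast
qed

section \<open>Orbits with three bounces\<close>

definition triangular_orbit :: "'a \<Rightarrow> 'a \<Rightarrow> 'a \<Rightarrow> int \<Rightarrow> 'a" where
  "triangular_orbit P Q R i = (if i mod 3 = 0 then P else if i mod 3 = 1 then Q else R)"

lemma triangular_orbit_neighbours:
  fixes i :: int
  obtains "i mod 3 = 0" "(i + 1) mod 3 = 1" "(i - 1) mod 3 = 2"
  | "i mod 3 = 1" "(i + 1) mod 3 = 2" "(i - 1) mod 3 = 0"
  | "i mod 3 = 2" "(i + 1) mod 3 = 0" "(i - 1) mod 3 = 1"
proof -
  have "i mod 3 = 0 \<and> (i + 1) mod 3 = 1 \<and> (i - 1) mod 3 = 2 \<or>
    i mod 3 = 1 \<and> (i + 1) mod 3 = 2 \<and> (i - 1) mod 3 = 0 \<or>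
    i mod 3 = 2 \<and> (i + 1) mod 3 = 0 \<and> (i - 1) mod 3 = 1"
    by presburger
  with that show ?thesis by blast
qed

lemma all_triangular_orbit:
  "(\<forall>i. F (triangular_orbit P Q R (i - 1)) (triangular_orbit P Q R i) (triangular_orbit P Q R (i + 1)))
    \<longleftrightarrow> F R P Q \<and> F P Q R \<and> F Q R P" (is "?L \<longleftrightarrow> ?R")
proof
  assume ?L
  from this[rule_format, of 0] this[rule_format, of 1] this[rule_format, of 2] show ?R
    by (simp add: triangular_orbit_def)
next
  assume R: ?R
  show ?L
  proof
    fix i :: int
    show "F (triangular_orbit P Q R (i - 1)) (triangular_orbit P Q R i) (triangular_orbit P Q R (i + 1))"
      by (cases rule: triangular_orbit_neighbours[of i]) (use R in \<open>simp_all add: triangular_orbit_def\<close>)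
  qed
qed

lemma closes_after_3_eq:
  assumes "closes_after q 3"
  shows "q = triangular_orbit (q 0) (q 1) (q 2)"
proof
  fix i :: int
  have per: "q (j + 3) = q j" for j
    using assms unfolding closes_after_def by simp
  have nat: "q (j + 3 * int n) = q j" for j n
  proof (induction n)
    case (Suc n)
    have "q (j + 3 * int (Suc n)) = q ((j + 3 * int n) + 3)"
      by (simp add: algebra_simps)
    then show ?case using per Suc by metis
  qed simp
  have decomp: "i = 3 * (i div 3) + i mod 3"
    by (simp only: mult_div_mod_eq)
  have "q i = q (i mod 3)"
  proof (cases "i div 3 \<ge> 0")
    case True
    then have "i mod 3 + 3 * int (nat (i div 3)) = i"
      using decomp by linarith
    then show ?thesis using nat[of "i mod 3" "nat (i div 3)"] by (simp only:)
  next
    case False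
    then have "i + 3 * int (nat (- (i div 3))) = i mod 3"
      using decomp by linarith
    then show ?thesis using nat[of i "nat (- (i div 3))"] by (simp only:)
  qed
  then show "q i = triangular_orbit (q 0) (q 1) (q 2) i"
    by (cases rule: triangular_orbit_neighbours[of i]) (simp_all add: triangular_orbit_def)
qed

lemma orbit_trace_triangular:
  "orbit_trace (triangular_orbit P Q R)
    = closed_segment P Q \<union> closed_segment Q R \<union> closed_segment R P"
proof -
  \<comment> \<open>Stated for the complement, the union over all bounces is a universal statement.\<close>
  have "x \<notin> orbit_trace (triangular_orbit P Q R) \<longleftrightarrow>
      x \<notin> closed_segment P Q \<union> closed_segment Q R \<union> closed_segment R P" for x
    using all_triangular_orbit[of "\<lambda>X Y Z. x \<notin> closed_segment Y Z" P Q R]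
    unfolding orbit_trace_def by auto
  then show ?thesis by blast
qed

lemma regular_3_bounce_triangular:
  "regular_orbit T (triangular_orbit P Q R) \<and> bounce_orbit 3 T (triangular_orbit P Q R) \<longleftrightarrow>
     P \<noteq> Q \<and> Q \<noteq> R \<and> R \<noteq> P \<and>
     smooth_point T P \<and> smooth_point T Q \<and> smooth_point T R \<and>
     outward_support_vector T P (bounce_vector P Q R) \<and>
     outward_support_vector T Q (bounce_vector Q R P) \<and>
     outward_support_vector T R (bounce_vector R P Q)" (is "_ \<longleftrightarrow> ?R")
proof -
  let ?q = "triangular_orbit P Q R"
  have "closes_after ?q 3"
    unfolding closes_after_def triangular_orbit_def by simp
  moreover have "\<not> closes_after ?q m" if "m < 3" "P \<noteq> Q \<and> Q \<noteq> R \<and> R \<noteq> P" for m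
  proof
    assume "closes_after ?q m"
    moreover from this that(1) have "m = 2" unfolding closes_after_def by simp
    ultimately have "?q (0 + int 2) = ?q 0" unfolding closes_after_def by blast
    with that(2) show False by (simp add: triangular_orbit_def)
  qed
  moreover have "billiard_orbit T ?q \<and> (\<forall>i. smooth_point T (?q i)) \<longleftrightarrow> ?R"
    unfolding billiard_orbit_def bounce_vector_def[symmetric]
      all_triangular_orbit[of "\<lambda>X Y Z. Y \<in> frontier T" P Q R]
      all_triangular_orbit[of "\<lambda>X Y Z. Y \<noteq> Z" P Q R]
      all_triangular_orbit[of "\<lambda>X Y Z. smooth_point T Y" P Q R]
      all_triangular_orbit[of "\<lambda>X Y Z. outward_support_vector T Y (bounce_vector Y X Z)" P Q R]
      bounce_vector_commute[of P R Q] bounce_vector_commute[of Q P R] bounce_vector_commute[of R Q P]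
    using smooth_point_frontier[of T] by blast
  ultimately show ?thesis
    unfolding regular_orbit_def bounce_orbit_def by blast
qed

text \<open>
  A degenerate orbit runs back and forth on a line. The bounce vector vanishes at the middle point,
  where the reflection law says nothing, so smoothness has to exclude it: at an outer point \<open>P\<close> both
  the line orthogonal to the segment and the line containing it would support the polygon.
\<close>

lemma collinear_bounce_not_smooth:
  assumes T: "convex_polygon T" and dist: "P \<noteq> Q" "Q \<noteq> R" and btw: "between (P, R) Q"
    and smooth: "smooth_point T P" "smooth_point T Q" and R: "R \<in> T"
    and sup: "outward_support_vector T P (bounce_vector P Q R)"
  shows False
proof -
  define v where "v = bounce_vector P Q R"
  obtain t where t: "0 \<le> t" "t \<le> 1" "Q = (1 - t) *\<^sub>R P + t *\<^sub>R R"
    using btw unfolding between_mem_segment in_segment by blast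
  have "t \<noteq> 0" "t \<noteq> 1" using t dist by auto
  with t have t01: "0 < t" "t < 1" by auto
  have PQ: "P - Q = t *\<^sub>R (P - R)" and RQ: "R - Q = (t - 1) *\<^sub>R (P - R)"
    unfolding t(3) by (simp_all add: algebra_simps)
  have "P \<noteq> R" using PQ dist by auto
  have "(t *\<^sub>R (P - R)) /\<^sub>R norm (t *\<^sub>R (P - R)) = (P - R) /\<^sub>R norm (P - R)"
  proof -
    have "t * inverse (\<bar>t\<bar> * norm (P - R)) = inverse (norm (P - R))"
      using t01 by simp
    then show ?thesis by (simp only: norm_scaleR scaleR_scaleR mult.commute)
  qed
  then have v: "v = 2 *\<^sub>R ((P - R) /\<^sub>R norm (P - R))"
    unfolding v_def bounce_vector_def PQ by (simp only: scaleR_2)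
  have "(P - Q) \<bullet> v > 0"
    unfolding v PQ using t01 \<open>P \<noteq> R\<close> by simp
  then have Qv: "(Q - P) \<bullet> v \<noteq> 0"
    by (simp add: inner_diff_left)
  have "v \<noteq> 0" using Qv by auto
  obtain e where e: "e edge_of T" "P \<in> rel_interior e"
    using smooth_point_imp_edge[OF T smooth(1)] by blast
  have line_v: "affine hull e = {x. (x - P) \<bullet> v = 0}"
    using edge_hyperplane[OF T e \<open>v \<noteq> 0\<close>] sup unfolding outward_support_vector_def v_def by blast
  \<comment> \<open>A supporting line at the inner point \<open>Q\<close> of the segment contains the segment, so it supports
    \<open>T\<close> at \<open>P\<close> as well.\<close>
  obtain L where "is_line L" "Q \<in> L" "L \<inter> interior T = {}"
    using smooth(2) unfolding smooth_point_def by blast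
  then obtain n where n: "n \<noteq> 0" "\<And>x. x \<in> T \<Longrightarrow> (x - Q) \<bullet> n \<le> 0"
    using line_avoiding_interior_supports[OF T] by metis
  have "P \<in> T" using smooth_point_frontier[OF smooth(1)] convex_polygonD(5)[OF T] by blast
  have "t * ((P - R) \<bullet> n) \<le> 0" "(t - 1) * ((P - R) \<bullet> n) \<le> 0"
    using n(2)[OF \<open>P \<in> T\<close>] n(2)[OF R] unfolding PQ RQ by simp_all
  then have "(P - R) \<bullet> n = 0"
    using t01 by (auto simp: mult_le_0_iff)
  then have PQn: "(P - Q) \<bullet> n = 0"
    unfolding PQ by simp
  have "(x - P) \<bullet> n \<le> 0" if "x \<in> T" for x
    using n(2)[OF that] PQn by (simp add: inner_diff_left)
  then have line_n: "affine hull e = {x. (x - P) \<bullet> n = 0}"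
    using edge_hyperplane[OF T e n(1)] by blast
  have "Q \<in> {x. (x - P) \<bullet> n = 0}"
    using PQn by (simp add: inner_diff_left)
  with line_n line_v Qv show False by blast
qed

lemma smooth_bounce_triangle_noncollinear:
  assumes T: "convex_polygon T" and dist: "P \<noteq> Q" "Q \<noteq> R" "R \<noteq> P"
    and smooth: "smooth_point T P" "smooth_point T Q" "smooth_point T R"
    and sup: "outward_support_vector T P (bounce_vector P Q R)"
      "outward_support_vector T Q (bounce_vector Q R P)"
      "outward_support_vector T R (bounce_vector R P Q)"
  shows "\<not> collinear {P, Q, R}"
proof
  have inT: "P \<in> T" "Q \<in> T" "R \<in> T"
    using smooth[THEN smooth_point_frontier] convex_polygonD(5)[OF T] by blast+
  assume "collinear {P, Q, R}"
  then consider "between (Q, R) P" | "between (R, P) Q" | "between (P, Q) R"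
    unfolding collinear_between_cases by blast
  then show False
  proof cases
    case 1
    show False
      using collinear_bounce_not_smooth[OF T, of Q P R] dist 1 smooth sup inT
      by (simp add: bounce_vector_commute)
  next
    case 2
    show False
      using collinear_bounce_not_smooth[OF T, of R Q P] dist 2 smooth sup inT
      by (simp add: bounce_vector_commute)
  next
    case 3
    show False
      using collinear_bounce_not_smooth[OF T, of P R Q] dist 3 smooth sup inT
      by (simp add: bounce_vector_commute)
  qed
qed

section \<open>Orbits and Fagnano triangles\<close>

text \<open>
  The triangle is the excentral triangle of the three bounce points: the edge through a bounce point lies
  on the external bisector, and the bounce points are the feet of the altitudes.
\<close>

lemma regular_3_bounce_trace_is_fagnano:
  assumes T: "convex_polygon T" and q: "regular_orbit T q" "bounce_orbit 3 T q"
  obtains A B C e1 e2 e3 where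
    "orbit_trace q = fagnano_triangle A B C" "acute_triangle A B C" "T \<subseteq> convex hull {A, B, C}"
    "e1 edge_of T" "e2 edge_of T" "e3 edge_of T"
    "cut_out_by A B C (affine hull e1) (affine hull e2) (affine hull e3)"
    "orthogonal_projection (affine hull e1) A \<in> rel_interior e1"
    "orthogonal_projection (affine hull e2) B \<in> rel_interior e2"
    "orthogonal_projection (affine hull e3) C \<in> rel_interior e3"
proof -
  define P Q R where "P = q 0" "Q = q 1" "R = q 2"
  have q_eq: "q = triangular_orbit P Q R"
    unfolding P_Q_R_def using q(2) by (intro closes_after_3_eq) (simp add: bounce_orbit_def)
  have orbit: "P \<noteq> Q" "Q \<noteq> R" "R \<noteq> P"
    "smooth_point T P" "smooth_point T Q" "smooth_point T R"
    "outward_support_vector T P (bounce_vector P Q R)"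
    "outward_support_vector T Q (bounce_vector Q R P)"
    "outward_support_vector T R (bounce_vector R P Q)"
    using regular_3_bounce_triangular[of T P Q R] q unfolding q_eq by blast+
  have nc: "\<not> collinear {P, Q, R}"
    by (rule smooth_bounce_triangle_noncollinear[OF T orbit])
  note nc' = noncollinear_cyclic[OF nc]
  define A B C where "A = excenter P Q R" "B = excenter Q R P" "C = excenter R P Q"
  note defs = A_B_C_def
  have edge: "\<exists>e. e edge_of T \<and> X \<in> rel_interior e \<and>
      affine hull e = affine hull {excenter Y Z X, excenter Z X Y}"
    if nc: "\<not> collinear {X, Y, Z}" and X: "smooth_point T X"
      "outward_support_vector T X (bounce_vector X Y Z)" for X Y Z
  proof -
    obtain e where e: "e edge_of T" "X \<in> rel_interior e"
      using smooth_point_imp_edge[OF T X(1)] by blast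
    have "bounce_vector X Y Z \<noteq> 0"
      using excenter_bounce_vector[OF nc] excenter_neq(1)[OF nc] by force
    with edge_hyperplane[OF T e] X(2) excenter_line[OF nc] e show ?thesis
      unfolding outward_support_vector_def by blast
  qed
  obtain e1 where e1: "e1 edge_of T" "P \<in> rel_interior e1" "affine hull e1 = affine hull {B, C}"
    using edge[OF nc orbit(4,7)] unfolding defs by blast
  obtain e2 where e2: "e2 edge_of T" "Q \<in> rel_interior e2" "affine hull e2 = affine hull {C, A}"
    using edge[OF nc'(1) orbit(5,8)] unfolding defs by blast
  obtain e3 where e3: "e3 edge_of T" "R \<in> rel_interior e3" "affine hull e3 = affine hull {A, B}"
    using edge[OF nc'(2) orbit(6,9)] unfolding defs by blast
  have acute: "acute_triangle A B C"
    unfolding defs by (rule excentral_acute[OF nc])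
  have ncA: "\<not> collinear {A, B, C}"
    using acute unfolding acute_triangle_def by blast
  have proj: "orthogonal_projection (affine hull {B, C}) A = P"
    "orthogonal_projection (affine hull {C, A}) B = Q"
    "orthogonal_projection (affine hull {A, B}) C = R"
    unfolding defs using excenter_projection[OF nc] excenter_projection[OF nc'(1)]
      excenter_projection[OF nc'(2)] by simp_all
  show ?thesis
  proof (rule that)
    show "orbit_trace q = fagnano_triangle A B C"
      unfolding q_eq orbit_trace_triangular fagnano_triangle_def proj Let_def ..
    show "T \<subseteq> convex hull {A, B, C}"
      unfolding defs using excentral_hull[OF nc] orbit(7-9)
      unfolding outward_support_vector_def by blast
    show "cut_out_by A B C (affine hull e1) (affine hull e2) (affine hull e3)"
      unfolding cut_out_by_def e1(3) e2(3) e3(3)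
      using triangle_sides_meet[OF ncA] triangle_sides_meet[OF noncollinear_cyclic(1)[OF ncA]]
        triangle_sides_meet[OF noncollinear_cyclic(2)[OF ncA]] by blast
  qed (use acute e1 e2 e3 proj in simp_all)
qed

text \<open>
  The feet of the altitudes, visited cyclically, form the orbit. They are smooth as relatively interior
  points of edges, and \<open>T\<close> lies below each side of the triangle, so outward normals of the sides are
  support vectors of \<open>T\<close>.
\<close>

lemma fagnano_is_regular_3_bounce_trace:
  assumes T: "convex_polygon T" "T \<subseteq> convex hull {A, B, C}"
    and acute: "acute_triangle A B C"
    and e: "e1 edge_of T" "e2 edge_of T" "e3 edge_of T"
    and cut: "cut_out_by A B C (affine hull e1) (affine hull e2) (affine hull e3)"
    and feet: "orthogonal_projection (affine hull e1) A \<in> rel_interior e1"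
      "orthogonal_projection (affine hull e2) B \<in> rel_interior e2"
      "orthogonal_projection (affine hull e3) C \<in> rel_interior e3"
  obtains q where "fagnano_triangle A B C = orbit_trace q" "regular_orbit T q" "bounce_orbit 3 T q"
proof -
  have nc: "\<not> collinear {A, B, C}"
    using acute unfolding acute_triangle_def by blast
  note n = noncollinear_distinct[OF nc]
  have line: "is_line (affine hull e1)" "is_line (affine hull e2)" "is_line (affine hull e3)"
    using e by (simp_all add: is_line_def edge_of_def)
  have sides: "affine hull e1 = affine hull {B, C}" "affine hull e2 = affine hull {C, A}"
      "affine hull e3 = affine hull {A, B}"
  proof -
    have "A \<in> affine hull e2 \<inter> affine hull e3" "B \<in> affine hull e3 \<inter> affine hull e1"
      "C \<in> affine hull e1 \<inter> affine hull e2"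
      using cut unfolding cut_out_by_def by simp_all
    then show "affine hull e1 = affine hull {B, C}" "affine hull e2 = affine hull {C, A}"
      "affine hull e3 = affine hull {A, B}"
      using affine_hull_2_eq_line[OF line(1), of B C] affine_hull_2_eq_line[OF line(2), of C A]
        affine_hull_2_eq_line[OF line(3), of A B] n by blast+
  qed
  define P Q R where "P = orthogonal_projection (affine hull {B, C}) A"
    "Q = orthogonal_projection (affine hull {C, A}) B"
    "R = orthogonal_projection (affine hull {A, B}) C"
  note defs = P_Q_R_def
  have P: "P \<in> affine hull {B, C}" "(A - P) \<bullet> (C - B) = 0"
    and Q: "Q \<in> affine hull {C, A}" "(B - Q) \<bullet> (A - C) = 0"
    and R: "R \<in> affine hull {A, B}" "(C - R) \<bullet> (B - A) = 0"
    unfolding defs using n by (simp_all add: foot_of_altitude)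
  have smooth: "smooth_point T P" "smooth_point T Q" "smooth_point T R"
    using feet rel_interior_edge_smooth[OF T(1)] e unfolding sides defs by blast+
  have T': "T \<subseteq> convex hull {B, C, A}" "T \<subseteq> convex hull {C, A, B}"
    using T(2) by (simp_all add: insert_commute)
  have acute': "acute_triangle B C A" "acute_triangle C A B"
    using acute noncollinear_cyclic[OF nc] unfolding acute_triangle_iff by blast+
  show ?thesis
  proof (rule that)
    show "fagnano_triangle A B C = orbit_trace (triangular_orbit P Q R)"
      unfolding orbit_trace_triangular fagnano_triangle_def defs Let_def ..
    have "regular_orbit T (triangular_orbit P Q R) \<and> bounce_orbit 3 T (triangular_orbit P Q R)"
      unfolding regular_3_bounce_triangular
      using foot_bounce_support[OF T acute P smooth(1) Q R]
        foot_bounce_support[OF T(1) T'(1) acute'(1) Q smooth(2) R P]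
        foot_bounce_support[OF T(1) T'(2) acute'(2) R smooth(3) P Q] smooth by blast
    then show "regular_orbit T (triangular_orbit P Q R)" "bounce_orbit 3 T (triangular_orbit P Q R)"
      by blast+
  qed
qed

theorem mainTheorem4:
  fixes T :: "(real ^ 2) set"
  assumes "convex_polygon T"
  shows
    "{orbit_trace q | q. regular_orbit T q \<and> bounce_orbit 3 T q} =
     {fagnano_triangle A B C | A B C.
        acute_triangle A B C \<and>
        T \<subseteq> convex hull {A, B, C} \<and>
        (\<exists>e1 e2 e3.
           e1 edge_of T \<and> e2 edge_of T \<and> e3 edge_of T \<and>
           cut_out_by A B C (affine hull e1) (affine hull e2) (affine hull e3) \<and>
           orthogonal_projection (affine hull e1) A \<in> rel_interior e1 \<and>
           orthogonal_projection (affine hull e2) B \<in> rel_interior e2 \<and>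
           orthogonal_projection (affine hull e3) C \<in> rel_interior e3)}"
    (is "?traces = ?fagnano")
proof
  show "?traces \<subseteq> ?fagnano"
  proof
    fix X assume "X \<in> ?traces"
    then obtain q where "X = orbit_trace q" and q: "regular_orbit T q" "bounce_orbit 3 T q"
      by blast
    then show "X \<in> ?fagnano"
      by (cases rule: regular_3_bounce_trace_is_fagnano[OF assms q]) blast
  qed
  show "?fagnano \<subseteq> ?traces"
  proof
    fix X assume "X \<in> ?fagnano"
    then obtain A B C e1 e2 e3 where X: "X = fagnano_triangle A B C" and
      triangle: "T \<subseteq> convex hull {A, B, C}" "acute_triangle A B C"
        "e1 edge_of T" "e2 edge_of T" "e3 edge_of T"
        "cut_out_by A B C (affine hull e1) (affine hull e2) (affine hull e3)"
        "orthogonal_projection (affine hull e1) A \<in> rel_interior e1"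
        "orthogonal_projection (affine hull e2) B \<in> rel_interior e2"
        "orthogonal_projection (affine hull e3) C \<in> rel_interior e3"
      by blast
    show "X \<in> ?traces"
      unfolding X by (cases rule: fagnano_is_regular_3_bounce_trace[OF assms triangle]) blast
  qed
qed

end
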